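(* Let $n\ge0$. (1) For any $b\in\mathcal A_n$, $$\inf\big\{\mathcal E_{n+1}[a]:\ a\in\mathcal A_{n+1},\ \rho_n(a)=b\big\}=\tfrac35\,\mathcal E_n[b].$$ (2) The lower bound is attained at one and only one element of $\mathcal A_{n+1}$, namely $(id_n\otimes\varphi)(b)$.
   Context: Indices $j\in\{1,2,3\}$ are taken mod $3$. $M_3(\mathbb C)$ has matrix units $e_{ij}$, and $\mathbb C^3$ is identified with its diagonal subalgebra. For $n\ge0$ put $\alpha^n_j=e_{jj}\otimes e_{22}^{\otimes n}\in M_3(\mathbb C)^{\otimes(n+1)}$, and for $k\ge1$ put $\beta^k_j=(e_{jj}\otimes e_{11}+e_{j+2,j+2}\otimes e_{33})\otimes e_{22}^{\otimes(k-1)}\in M_3(\mathbb C)^{\otimes(k+1)}$. The finite-dimensional $*$-algebra $\mathcal A_n\subset M_3(\mathbb C)^{\otimes n}\otimes\mathbb C^3\subset M_3(\mathbb C)^{\otimes(n+1)}$ is the linear span of the $\alpha^n_j$ and of the $x\otimes\beta^k_j$ with $j=1,2,3$, $k=1,\dots,n$, $x\in M_3(\mathbb C)^{\otimes(n-k)}$. The map $\rho_n:\mathcal A_{n+1}\to\mathcal A_n$ is the restriction of the slice map $id_{n+1}\otimes e_{22}^*:M_3(\mathbb C)^{\otimes(n+2)}\to M_3(\mathbb C)^{\otimes(n+1)}$, where $id_{n+1}$ is the identity of $M_3(\mathbb C)^{\otimes(n+1)}$ and $e_{22}^*(m)=m_{22}$. Let $V_0=\{v_1,v_2,v_3\}$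 be a three-point set and identify $\mathbb C^3=\mathbb C(V_0)$ with $e_{ii}$ the indicator function of $v_i$; so $b\in M_3(\mathbb C)^{\otimes n}\otimes\mathbb C^3$ is written $b=\sum_i b(v_i)\otimes e_{ii}$ with $b(v_i)\in M_3(\mathbb C)^{\otimes n}$. For $b\in\mathcal A_n$, $\mathcal E_n[b]=\sum_{i\ne j}\mathrm{Tr}\big(|b(v_i)-b(v_j)|^2\big)$, where $\mathrm{Tr}$ is the unnormalized trace on $M_3(\mathbb C)^{\otimes n}$ and $i,j$ range over $\{1,2,3\}$. The harmonic extension $\varphi:\mathcal A_0=\mathbb C^3\to\mathcal A_1\subset\mathbb C^3\otimes\mathbb C^3$ is the linear map $\varphi(\alpha^0_j)=\alpha^1_j+\tfrac25\beta^1_j+\tfrac25\beta^1_{j+1}+\tfrac15\beta^1_{j-1}$, and $id_n\otimes\varphi:M_3(\mathbb C)^{\otimes n}\otimes\mathbb C^3\to M_3(\mathbb C)^{\otimes n}\otimes\mathcal A_1$ maps $\mathcal A_n$ into $\mathcal A_{n+1}$. *)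

theory Defs
  imports "Jordan_Normal_Form.VS_Connect" "Jordan_Normal_Form.Schur_Decomposition"
begin

text \<open>
  Elements of $M_3(\mathbb C)^{\otimes n}$ are the complex $3^n \times 3^n$ matrices, with the
  Kronecker product as tensor product; the last tensor factor is the least significant
  ternary digit of a row or column number.
\<close>

definition kron :: "complex mat \<Rightarrow> complex mat \<Rightarrow> complex mat"  (infixl "\<otimes>\<^sub>m" 72) where
  "A \<otimes>\<^sub>m B = mat (dim_row A * dim_row B) (dim_col A * dim_col B)
     (\<lambda>(r, c). A $$ (r div dim_row B, c div dim_col B) * B $$ (r mod dim_row B, c mod dim_col B))"

primrec kron_pow :: "complex mat \<Rightarrow> nat \<Rightarrow> complex mat" where
  "kron_pow A 0 = 1\<^sub>m 1"
| "kron_pow A (Suc n) = A \<otimes>\<^sub>m kron_pow A n"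

text \<open>
  The indices 1, 2, 3 (read mod 3) correspond to the rows and columns 0, 1, 2 of a matrix;
  $j - 1$ is written $j + 2$.
\<close>

definition pos :: "nat \<Rightarrow> nat" where
  "pos i = (i + 2) mod 3"

definition munit :: "nat \<Rightarrow> nat \<Rightarrow> complex mat" where
  "munit i j = mat 3 3 (\<lambda>(r, c). if r = pos i \<and> c = pos j then 1 else 0)"

definition alpha :: "nat \<Rightarrow> nat \<Rightarrow> complex mat" where
  "alpha n j = munit j j \<otimes>\<^sub>m kron_pow (munit 2 2) n"

definition beta :: "nat \<Rightarrow> nat \<Rightarrow> complex mat" where
  "beta k j = (munit j j \<otimes>\<^sub>m munit 1 1 + munit (j + 2) (j + 2) \<otimes>\<^sub>m munit 3 3)
     \<otimes>\<^sub>m kron_pow (munit 2 2) (k - 1)"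

definition alg :: "nat \<Rightarrow> complex mat set" where
  "alg n = LinearCombinations.module.span class_ring
     (module_mat TYPE(complex) (3 ^ (n + 1)) (3 ^ (n + 1)))
     ({alpha n j | j. j \<in> {1, 2, 3}} \<union>
      {x \<otimes>\<^sub>m beta k j | x k j. j \<in> {1, 2, 3} \<and> k \<in> {1..n} \<and>
         x \<in> carrier_mat (3 ^ (n - k)) (3 ^ (n - k))})"

text \<open>
  The slice map $id \otimes e_{ii}^*$ on the last tensor factor, where $e_{ii}^*(m) = m_{ii}$.
  For $b = \sum_i b(v_i) \otimes e_{ii}$ it returns $b(v_i)$.
\<close>

definition slice :: "nat \<Rightarrow> complex mat \<Rightarrow> complex mat" where
  "slice i a = mat (dim_row a div 3) (dim_col a div 3) (\<lambda>(r, c). a $$ (3 * r + pos i, 3 * c + pos i))"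

text \<open>
  The number of tensor factors is determined by the size of the matrix, so the maps
  $\rho_n$, $\mathcal E_n$ and $id_n \otimes \varphi$ need no parameter $n$.
\<close>

definition rho :: "complex mat \<Rightarrow> complex mat" where
  "rho a = slice 2 a"

definition mat_trace :: "complex mat \<Rightarrow> complex" where
  "mat_trace A = (\<Sum>i<dim_row A. A $$ (i, i))"

text \<open>The trace of $|x|^2 = x^* x$ is real and nonnegative; \<open>Re\<close> only changes its type.\<close>

definition energy :: "complex mat \<Rightarrow> real" where
  "energy b = (\<Sum>(i, j) \<in> {(i, j). i \<in> {1, 2, 3} \<and> j \<in> {1, 2, 3} \<and> i \<noteq> j}.
     Re (mat_trace (mat_adjoint (slice i b - slice j b) * (slice i b - slice j b))))"

definition phi_alpha :: "nat \<Rightarrow> complex mat" where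
  "phi_alpha j = alpha 1 j + (2/5) \<cdot>\<^sub>m beta 1 j + (2/5) \<cdot>\<^sub>m beta 1 (j + 1) + (1/5) \<cdot>\<^sub>m beta 1 (j + 2)"

text \<open>
  The harmonic extension, applied to a diagonal $3 \times 3$ matrix
  $x = \sum_j x_{jj} \alpha^0_j$.
\<close>

definition phi :: "complex mat \<Rightarrow> complex mat" where
  "phi x = (x $$ (pos 1, pos 1)) \<cdot>\<^sub>m phi_alpha 1 + (x $$ (pos 2, pos 2)) \<cdot>\<^sub>m phi_alpha 2
     + (x $$ (pos 3, pos 3)) \<cdot>\<^sub>m phi_alpha 3"

definition id_tensor_phi :: "complex mat \<Rightarrow> complex mat" where
  "id_tensor_phi b = slice 1 b \<otimes>\<^sub>m phi (munit 1 1) + slice 2 b \<otimes>\<^sub>m phi (munit 2 2)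
     + slice 3 b \<otimes>\<^sub>m phi (munit 3 3)"

end

theory Submission
  imports Defs
begin

text \<open>
  The elements of \<open>alg (n + 1)\<close> with a given restriction \<open>b\<close> have three free matrix
  coefficients, namely those of the \<open>beta 1 j\<close>. In them the energy is, entry by entry,
  the energy of a triangle with prescribed values at the corners and free values at the three
  midpoints. Completing the square at the harmonic values turns it into \<open>3/5 * energy b\<close> plus a
  positive definite form in the deviation from these values, which gives the infimum and the
  uniqueness of the minimiser at the same time.
\<close>

section \<open>Kronecker products\<close>

lemma dim_kron [simp]:
  "dim_row (A \<otimes>\<^sub>m B) = dim_row A * dim_row B"
  "dim_col (A \<otimes>\<^sub>m B) = dim_col A * dim_col B"
  by (simp_all add: kron_def)

lemma kron_carrier [simp, intro]:
  "A \<in> carrier_mat k l \<Longrightarrow> B \<in> carrier_mat m p \<Longrightarrow> A \<otimes>\<^sub>m B \<in> carrier_mat (k * m) (l * p)"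
  by (metis carrier_matD carrier_matI dim_kron)

lemma index_kron [simp]:
  assumes "r < dim_row A * dim_row B" "c < dim_col A * dim_col B"
  shows "(A \<otimes>\<^sub>m B) $$ (r, c) =
    A $$ (r div dim_row B, c div dim_col B) * B $$ (r mod dim_row B, c mod dim_col B)"
  using assms by (simp add: kron_def)

lemma div_mod_less_mult:
  fixes r m n :: nat
  assumes "r < m * n"
  shows "r div n < m" "r mod n < n"
  using assms by (auto simp: less_mult_imp_div_less intro!: mod_less_divisor gr0I)

lemma kron_add_left:
  assumes "A \<in> carrier_mat k l" "A' \<in> carrier_mat k l"
  shows "(A + A') \<otimes>\<^sub>m B = A \<otimes>\<^sub>m B + A' \<otimes>\<^sub>m B"
  using assms by (intro eq_matI) (auto simp: div_mod_less_mult algebra_simps)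

lemma kron_add_right:
  assumes "B \<in> carrier_mat k l" "B' \<in> carrier_mat k l"
  shows "A \<otimes>\<^sub>m (B + B') = A \<otimes>\<^sub>m B + A \<otimes>\<^sub>m B'"
  using assms by (intro eq_matI) (auto simp: div_mod_less_mult algebra_simps)

lemma kron_smult_left: "(s \<cdot>\<^sub>m A) \<otimes>\<^sub>m B = s \<cdot>\<^sub>m (A \<otimes>\<^sub>m B)"
  by (intro eq_matI) (auto simp: div_mod_less_mult)

lemma kron_zero_left: "0\<^sub>m k l \<otimes>\<^sub>m B = 0\<^sub>m (k * dim_row B) (l * dim_col B)"
  by (intro eq_matI) (auto simp: div_mod_less_mult)

text \<open>Both groupings read the same three mixed-radix digits off a row or column number, so
  only identities for iterated \<open>div\<close> and \<open>mod\<close> are at stake.\<close>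

lemma kron_assoc: "A \<otimes>\<^sub>m B \<otimes>\<^sub>m C = A \<otimes>\<^sub>m (B \<otimes>\<^sub>m C)"
proof (intro eq_matI)
  fix r c
  assume "r < dim_row (A \<otimes>\<^sub>m (B \<otimes>\<^sub>m C))" "c < dim_col (A \<otimes>\<^sub>m (B \<otimes>\<^sub>m C))"
  then have rc: "r < dim_row A * (dim_row B * dim_row C)" "c < dim_col A * (dim_col B * dim_col C)"
    by simp_all
  then have rc': "r < dim_row A * dim_row B * dim_row C" "c < dim_col A * dim_col B * dim_col C"
    by (simp_all add: mult.assoc)
  have digit: "x div n mod m = x mod (m * n) div n" "x div n div m = x div (m * n)"
    "x mod n = x mod (m * n) mod n" for x m n :: nat
    by (simp_all add: div_mult2_eq [symmetric] mod_mult2_eq' mult.commute [of m n] mod_mult2_eq)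
      (cases "n = 0"; simp add: mod_mult2_eq)+
  show "(A \<otimes>\<^sub>m B \<otimes>\<^sub>m C) $$ (r, c) = (A \<otimes>\<^sub>m (B \<otimes>\<^sub>m C)) $$ (r, c)"
    using rc rc' div_mod_less_mult[OF rc(1)] div_mod_less_mult[OF rc(2)]
      div_mod_less_mult[OF rc'(1)] div_mod_less_mult[OF rc'(2)]
    by (simp add: digit [of r "dim_row C" "dim_row B"] digit [of c "dim_col C" "dim_col B"])
qed (simp_all add: mult.assoc)

lemma kron_one_left: "1\<^sub>m 1 \<otimes>\<^sub>m A = A"
  by (intro eq_matI) auto

lemma kron_one_right: "A \<otimes>\<^sub>m 1\<^sub>m 1 = A"
  by (intro eq_matI) auto

text \<open>\<open>kron_pow\<close> grows on the left, whereas passing to the next level adds a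
  factor on the right, the side on which \<open>rho\<close> slices.\<close>

lemma kron_pow_Suc_right: "kron_pow A (Suc n) = kron_pow A n \<otimes>\<^sub>m A"
proof (induction n)
  case 0
  then show ?case by (simp add: kron_one_left kron_one_right del: One_nat_def)
next
  case (Suc n)
  have "kron_pow A (Suc (Suc n)) = A \<otimes>\<^sub>m (kron_pow A n \<otimes>\<^sub>m A)"
    using Suc by simp
  then show ?case by (simp add: kron_assoc)
qed

lemma munit_carrier [simp, intro]: "munit i j \<in> carrier_mat 3 3"
  and dim_munit [simp]: "dim_row (munit i j) = 3" "dim_col (munit i j) = 3"
  by (simp_all add: munit_def)

lemma kron_pow_munit_carrier [simp, intro]: "kron_pow (munit i j) n \<in> carrier_mat (3 ^ n) (3 ^ n)"
  by (induction n) auto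

section \<open>Matrices that are diagonal in the last tensor factor\<close>

text \<open>The normal form for elements of M_3^n tensor C^3, read as matrix-valued functions on V_0
  with values \<open>A\<close>, \<open>B\<close>, \<open>C\<close> at v_1, v_2, v_3.\<close>

definition diag3 :: "complex mat \<Rightarrow> complex mat \<Rightarrow> complex mat \<Rightarrow> complex mat" where
  "diag3 A B C = A \<otimes>\<^sub>m munit 1 1 + B \<otimes>\<^sub>m munit 2 2 + C \<otimes>\<^sub>m munit 3 3"

text \<open>Matrix addition takes its dimensions from the right summand, hence from
  \<open>C\<close>.\<close>

lemma dim_diag3 [simp]:
  "dim_row (diag3 A B C) = dim_row C * 3" "dim_col (diag3 A B C) = dim_col C * 3"
  by (simp_all add: diag3_def)

lemma diag3_carrier [simp, intro]:
  "C \<in> carrier_mat k l \<Longrightarrow> diag3 A B C \<in> carrier_mat (k * 3) (l * 3)"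
  by (metis carrier_matD carrier_matI dim_diag3)

text \<open>The index j = 1, 2, 3 sits at the digit j - 1, so the last ternary digits of row and
  column select the block. Linear operations on \<open>diag3\<close> matrices thereby become
  blockwise.\<close>

lemma index_diag3:
  assumes "A \<in> carrier_mat k l" "B \<in> carrier_mat k l" "C \<in> carrier_mat k l"
    and "r < k * 3" "c < l * 3"
  shows "diag3 A B C $$ (r, c) =
    (if r mod 3 \<noteq> c mod 3 then 0
     else (if r mod 3 = 0 then A else if r mod 3 = 1 then B else C) $$ (r div 3, c div 3))"
proof -
  have "r mod 3 = 0 \<or> r mod 3 = 1 \<or> r mod 3 = 2" "c mod 3 = 0 \<or> c mod 3 = 1 \<or> c mod 3 = 2"
    by linarith+
  then show ?thesis
    using assms by (auto simp: diag3_def munit_def pos_def)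
qed

lemma diag3_add:
  assumes "A \<in> carrier_mat k l" "B \<in> carrier_mat k l" "C \<in> carrier_mat k l"
    and "A' \<in> carrier_mat k l" "B' \<in> carrier_mat k l" "C' \<in> carrier_mat k l"
  shows "diag3 A B C + diag3 A' B' C' = diag3 (A + A') (B + B') (C + C')"
  using assms by (intro eq_matI) (auto simp: index_diag3 [where k = k and l = l])

lemma diag3_minus:
  assumes "A \<in> carrier_mat k l" "B \<in> carrier_mat k l" "C \<in> carrier_mat k l"
    and "A' \<in> carrier_mat k l" "B' \<in> carrier_mat k l" "C' \<in> carrier_mat k l"
  shows "diag3 A B C - diag3 A' B' C' = diag3 (A - A') (B - B') (C - C')"
  using assms by (intro eq_matI) (auto simp: minus_carrier_mat index_diag3 [where k = k and l = l])

lemma diag3_smult: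
  assumes "A \<in> carrier_mat k l" "B \<in> carrier_mat k l" "C \<in> carrier_mat k l"
  shows "s \<cdot>\<^sub>m diag3 A B C = diag3 (s \<cdot>\<^sub>m A) (s \<cdot>\<^sub>m B) (s \<cdot>\<^sub>m C)"
  using assms by (intro eq_matI) (auto simp: index_diag3 [where k = k and l = l])

lemma diag3_zero: "diag3 (0\<^sub>m k l) (0\<^sub>m k l) (0\<^sub>m k l) = 0\<^sub>m (k * 3) (l * 3)"
  by (intro eq_matI) (auto simp: index_diag3 [where k = k and l = l])

lemma ternary_digit:
  fixes p k :: nat
  shows "Suc (3 * p) div 3 = p" "Suc (Suc (3 * p)) div 3 = p"
    "Suc (3 * p) mod 3 = 1" "Suc (Suc (3 * p)) mod 3 = 2"
    "p < k \<Longrightarrow> 3 * p < k * 3" "p < k \<Longrightarrow> Suc (3 * p) < k * 3"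
    "p < k \<Longrightarrow> Suc (Suc (3 * p)) < k * 3"
  by presburger+

lemma slice_diag3:
  assumes "A \<in> carrier_mat k l" "B \<in> carrier_mat k l" "C \<in> carrier_mat k l"
  shows "slice 1 (diag3 A B C) = A" "slice 2 (diag3 A B C) = B" "slice 3 (diag3 A B C) = C"
  using assms by (auto intro!: eq_matI simp: slice_def pos_def ternary_digit
      index_diag3 [where k = k and l = l])

lemma sum_lessThan_mult_3:
  fixes f :: "nat \<Rightarrow> 'a :: comm_monoid_add"
  shows "(\<Sum>r<k * 3. f r) = (\<Sum>p<k. f (3 * p) + f (3 * p + 1) + f (3 * p + 2))"
  by (induction k) (simp_all add: eval_nat_numeral add_ac)

section \<open>The Hilbert--Schmidt norm and the energy\<close>

text \<open>The square of the Hilbert-Schmidt norm. Being a sum over entries, it lets the energy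
  identity be checked on scalars.\<close>

definition hs :: "complex mat \<Rightarrow> real" where
  "hs A = (\<Sum>r<dim_row A. \<Sum>c<dim_col A. (cmod (A $$ (r, c)))\<^sup>2)"

lemma hs_nonneg: "0 \<le> hs A"
  by (simp add: hs_def sum_nonneg)

lemma hs_minus:
  assumes "A \<in> carrier_mat k l" "B \<in> carrier_mat k l"
  shows "hs (A - B) = (\<Sum>r<k. \<Sum>c<l. (cmod (A $$ (r, c) - B $$ (r, c)))\<^sup>2)"
  using assms by (auto simp: hs_def)

lemma hs_minus_commute:
  assumes "A \<in> carrier_mat k l" "B \<in> carrier_mat k l"
  shows "hs (A - B) = hs (B - A)"
  using assms by (simp add: hs_minus [where k = k and l = l] norm_minus_commute)

text \<open>Definiteness of the norm, from which uniqueness of the minimiser comes: a sum of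
  nonnegative terms vanishes only termwise.\<close>

lemma hs_minus_eq_0D:
  assumes "A \<in> carrier_mat k l" "B \<in> carrier_mat k l" "hs (A - B) = 0"
  shows "A = B"
  using assms
  by (intro eq_matI) (auto simp: hs_minus [where k = k and l = l] sum_nonneg_eq_0_iff sum_nonneg)

text \<open>Only entries whose row and column share the last ternary digit survive, and each digit
  contributes one block.\<close>

lemma hs_diag3:
  assumes "A \<in> carrier_mat k l" "B \<in> carrier_mat k l" "C \<in> carrier_mat k l"
  shows "hs (diag3 A B C) = hs A + hs B + hs C"
  using assms
  by (simp add: hs_def sum_lessThan_mult_3 index_diag3 [where k = k and l = l] ternary_digit
      sum.distrib)

text \<open>The i-th diagonal entry of the product is the squared norm of the i-th column;
  exchanging the two sums gives \<open>hs\<close>.\<close>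

lemma Re_mat_trace_adjoint: "Re (mat_trace (mat_adjoint A * A)) = hs A"
proof -
  have "(mat_adjoint A * A) $$ (i, i) = (\<Sum>r<dim_row A. of_real ((cmod (A $$ (r, i)))\<^sup>2))"
    if "i < dim_col A" for i
    using that
    by (auto simp: mat_adjoint_def scalar_prod_def mat_of_rows_index lessThan_atLeast0
        complex_norm_square [symmetric] mult.commute intro!: sum.cong)
  then show ?thesis
    by (simp add: mat_trace_def hs_def mat_adjoint_def sum.swap [of _ "{..<dim_col A}"])
qed

text \<open>The energy runs over ordered pairs of vertices, so each edge of the triangle counts
  twice.\<close>

lemma energy_diag3:
  assumes "A \<in> carrier_mat k l" "B \<in> carrier_mat k l" "C \<in> carrier_mat k l"
  shows "energy (diag3 A B C) = 2 * (hs (A - B) + hs (B - C) + hs (C - A))"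
proof -
  have "{(i, j). i \<in> {1, 2, 3} \<and> j \<in> {1, 2, 3} \<and> i \<noteq> j}
    = {(1, 2), (2, 1), (2, 3), (3, 2), (1, 3), (3, 1 :: nat)}"
    by auto
  then show ?thesis
    using assms hs_minus_commute [of A k l B] hs_minus_commute [of B k l C]
      hs_minus_commute [of C k l A]
    by (simp add: energy_def Re_mat_trace_adjoint slice_diag3 [where k = k and l = l]
        del: One_nat_def)
qed

section \<open>Structure of the algebras\<close>

definition gens :: "nat \<Rightarrow> complex mat set" where
  "gens n = {alpha n j | j. j \<in> {1, 2, 3}} \<union>
      {x \<otimes>\<^sub>m beta k j | x k j. j \<in> {1, 2, 3} \<and> k \<in> {1..n} \<and>
         x \<in> carrier_mat (3 ^ (n - k)) (3 ^ (n - k))}"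

lemma alpha_carrier [simp, intro]: "alpha n j \<in> carrier_mat (3 ^ Suc n) (3 ^ Suc n)"
  unfolding alpha_def power_Suc by (intro kron_carrier) auto

text \<open>At k = 0 the truncated exponent \<open>k - 1\<close> would still leave two tensor
  factors, a 9 by 9 matrix instead of a 3 by 3 one.\<close>

lemma beta_carrier:
  assumes "k \<ge> 1"
  shows "beta k j \<in> carrier_mat (3 ^ Suc k) (3 ^ Suc k)"
proof -
  have "(3::nat) ^ Suc k = 3 * 3 * 3 ^ (k - 1)"
    using assms by (cases k) auto
  then show ?thesis
    unfolding beta_def by (metis kron_carrier add_carrier_mat munit_carrier kron_pow_munit_carrier)
qed

lemma gens_carrier: "gens n \<subseteq> carrier_mat (3 ^ Suc n) (3 ^ Suc n)"
proof -
  have "x \<otimes>\<^sub>m beta k j \<in> carrier_mat (3 ^ Suc n) (3 ^ Suc n)"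
    if "k \<in> {1..n}" "x \<in> carrier_mat (3 ^ (n - k)) (3 ^ (n - k))" for x k j
  proof -
    have "(3::nat) ^ Suc n = 3 ^ (n - k) * 3 ^ Suc k"
      using that(1) by (simp flip: power_add)
    then show ?thesis
      using that beta_carrier [of k j] by (metis kron_carrier atLeastAtMost_iff)
  qed
  then show ?thesis
    using alpha_carrier unfolding gens_def by blast
qed

abbreviation (input) mats :: "nat \<Rightarrow> (complex, complex mat) module" where
  "mats n \<equiv> module_mat TYPE(complex) (3 ^ Suc n) (3 ^ Suc n)"

lemma module_mats: "Module.module class_ring (mats n)"
  using matrix_vs by (rule vectorspace.axioms)

lemma alg_eq_span: "alg n = LinearCombinations.module.span class_ring (mats n) (gens n)"
  by (simp add: alg_def gens_def)

lemma submodule_matsI: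
  assumes "N \<subseteq> carrier_mat (3 ^ Suc n) (3 ^ Suc n)" "0\<^sub>m (3 ^ Suc n) (3 ^ Suc n) \<in> N"
    and "\<And>x y. x \<in> N \<Longrightarrow> y \<in> N \<Longrightarrow> x + y \<in> N" "\<And>s x. x \<in> N \<Longrightarrow> s \<cdot>\<^sub>m x \<in> N"
  shows "submodule class_ring N (mats n)"
  using assms module_mats by (intro submodule.intro) (auto simp: module_mat_simps)

lemma submodule_alg: "submodule class_ring (alg n) (mats n)"
  unfolding alg_eq_span using gens_carrier
  by (intro module.span_is_submodule [OF module_mats]) (simp add: module_mat_simps)

text \<open>This serves as the induction principle for \<open>alg\<close>: a property that cuts out
  a submodule and holds on the generators holds throughout.\<close>

lemma alg_least: "submodule class_ring N (mats n) \<Longrightarrow> gens n \<subseteq> N \<Longrightarrow> alg n \<subseteq> N"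
  unfolding alg_eq_span by (rule module.span_is_subset [OF module_mats])

lemma gens_subset_alg: "gens n \<subseteq> alg n"
  unfolding alg_eq_span using gens_carrier
  by (intro module.in_own_span [OF module_mats]) (simp add: module_mat_simps)

lemma alg_carrier: "x \<in> alg n \<Longrightarrow> x \<in> carrier_mat (3 ^ Suc n) (3 ^ Suc n)"
  using submodule.subset [OF submodule_alg] by (auto simp: module_mat_simps)

lemma alg_zero: "0\<^sub>m (3 ^ Suc n) (3 ^ Suc n) \<in> alg n"
  using submodule.zero_closed [OF submodule_alg] by (simp add: module_mat_simps)

lemma alg_add: "x \<in> alg n \<Longrightarrow> y \<in> alg n \<Longrightarrow> x + y \<in> alg n"
  using submodule.m_closed [OF submodule_alg] by (simp add: module_mat_simps)

lemma alg_smult: "x \<in> alg n \<Longrightarrow> s \<cdot>\<^sub>m x \<in> alg n"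
  using submodule.smult_closed [OF submodule_alg, of s x n]
  by (simp add: module_mat_simps class_ring_simps)


section \<open>Generators under one more tensor factor\<close>

lemma alpha_0: "alpha 0 j = munit j j"
  by (simp add: alpha_def kron_one_right del: One_nat_def)

lemma alpha_Suc: "alpha (Suc n) j = alpha n j \<otimes>\<^sub>m munit 2 2"
  by (simp only: alpha_def kron_pow_Suc_right kron_assoc)

lemma beta_Suc:
  assumes "k \<ge> 1"
  shows "beta (Suc k) j = beta k j \<otimes>\<^sub>m munit 2 2"
proof -
  obtain m where "k = Suc m"
    using assms by (cases k) auto
  then show ?thesis
    by (simp only: beta_def diff_Suc_1 kron_pow_Suc_right kron_assoc)
qed

lemma beta_1: "beta 1 j = munit j j \<otimes>\<^sub>m munit 1 1 + munit (j + 2) (j + 2) \<otimes>\<^sub>m munit 3 3"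
  by (simp add: beta_def kron_one_right del: One_nat_def)

lemma munit_add_3: "munit (i + 3) (j + 3) = munit i j"
proof -
  have "pos (i + 3) = pos i" for i
    unfolding pos_def by presburger
  then show ?thesis
    by (simp only: munit_def)
qed

text \<open>The definitions leave indices unreduced mod 3. The largest that arises is 7, from
  \<open>beta 1 5\<close> in \<open>phi_alpha 3\<close>.\<close>

lemma munit_reduce:
  "munit 4 4 = munit 1 1" "munit 5 5 = munit 2 2" "munit 6 6 = munit 3 3" "munit 7 7 = munit 1 1"
  using munit_add_3 [of 1 1] munit_add_3 [of 2 2] munit_add_3 [of 3 3] munit_add_3 [of 4 4]
  by simp_all

lemma diag3_single:
  assumes "A \<in> carrier_mat k l"
  shows "diag3 A (0\<^sub>m k l) (0\<^sub>m k l) = A \<otimes>\<^sub>m munit 1 1"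
    "diag3 (0\<^sub>m k l) A (0\<^sub>m k l) = A \<otimes>\<^sub>m munit 2 2"
    "diag3 (0\<^sub>m k l) (0\<^sub>m k l) A = A \<otimes>\<^sub>m munit 3 3"
  using assms by (auto simp: diag3_def div_mod_less_mult intro!: eq_matI)

section \<open>Elements of the next level as extensions by midpoint values\<close>

text \<open>
  The blocks \<open>x\<close>, \<open>y\<close>, \<open>z\<close> are the
  coefficients of \<open>beta 1 1\<close>, \<open>beta 1 2\<close>, \<open>beta 1 3\<close>, that is, the values at the midpoints
  of the triangles of the next level.
\<close>

definition extension ::
    "complex mat \<Rightarrow> complex mat \<Rightarrow> complex mat \<Rightarrow> complex mat \<Rightarrow> complex mat" where
  "extension b x y z = diag3 (diag3 x y z) b (diag3 y z x)"

lemma extension_add: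
  assumes "b \<in> carrier_mat (k * 3) (l * 3)" "x \<in> carrier_mat k l" "y \<in> carrier_mat k l"
    "z \<in> carrier_mat k l"
    and "b' \<in> carrier_mat (k * 3) (l * 3)" "x' \<in> carrier_mat k l" "y' \<in> carrier_mat k l"
    "z' \<in> carrier_mat k l"
  shows "extension b x y z + extension b' x' y' z' =
    extension (b + b') (x + x') (y + y') (z + z')"
  using assms unfolding extension_def
  by (simp add: diag3_add [where k = "k * 3" and l = "l * 3"] diag3_add [where k = k and l = l])

lemma extension_smult:
  assumes "b \<in> carrier_mat (k * 3) (l * 3)" "x \<in> carrier_mat k l" "y \<in> carrier_mat k l"
    "z \<in> carrier_mat k l"
  shows "s \<cdot>\<^sub>m extension b x y z = extension (s \<cdot>\<^sub>m b) (s \<cdot>\<^sub>m x) (s \<cdot>\<^sub>m y) (s \<cdot>\<^sub>m z)"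
  using assms unfolding extension_def
  by (simp add: diag3_smult [where k = "k * 3" and l = "l * 3"] diag3_smult [where k = k and l = l])

lemma rho_extension:
  assumes "b \<in> carrier_mat (k * 3) (l * 3)" "x \<in> carrier_mat k l" "y \<in> carrier_mat k l"
    "z \<in> carrier_mat k l"
  shows "rho (extension b x y z) = b"
  using assms unfolding rho_def extension_def
  by (intro slice_diag3 [where k = "k * 3" and l = "l * 3"]) auto

text \<open>Together with \<open>extension_beta\<close>, this matches the four arguments of
  \<open>extension\<close> with the two kinds of generators in \<open>gens_Suc\<close>.\<close>

lemma extension_base:
  assumes "b \<in> carrier_mat (k * 3) (l * 3)"
  shows "extension b (0\<^sub>m k l) (0\<^sub>m k l) (0\<^sub>m k l) = b \<otimes>\<^sub>m munit 2 2"
  using assms by (simp add: extension_def diag3_zero diag3_single)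

lemma kron_beta_1:
  assumes "x \<in> carrier_mat k l"
  shows "x \<otimes>\<^sub>m beta 1 j =
    (x \<otimes>\<^sub>m munit j j) \<otimes>\<^sub>m munit 1 1 + (x \<otimes>\<^sub>m munit (j + 2) (j + 2)) \<otimes>\<^sub>m munit 3 3"
  unfolding beta_1 kron_assoc
  by (intro kron_add_right [where k = "3 * 3" and l = "3 * 3"] kron_carrier munit_carrier)

lemma extension_beta:
  assumes "x \<in> carrier_mat k l"
  shows "extension (0\<^sub>m (k * 3) (l * 3)) x (0\<^sub>m k l) (0\<^sub>m k l) = x \<otimes>\<^sub>m beta 1 1"
    "extension (0\<^sub>m (k * 3) (l * 3)) (0\<^sub>m k l) x (0\<^sub>m k l) = x \<otimes>\<^sub>m beta 1 2"
    "extension (0\<^sub>m (k * 3) (l * 3)) (0\<^sub>m k l) (0\<^sub>m k l) x = x \<otimes>\<^sub>m beta 1 3"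
proof -
  have "diag3 A (0\<^sub>m (k * 3) (l * 3)) C = A \<otimes>\<^sub>m munit 1 1 + C \<otimes>\<^sub>m munit 3 3"
    if "A \<in> carrier_mat (k * 3) (l * 3)" "C \<in> carrier_mat (k * 3) (l * 3)" for A C
    using that by (intro eq_matI) (auto simp: diag3_def div_mod_less_mult)
  then show
    "extension (0\<^sub>m (k * 3) (l * 3)) x (0\<^sub>m k l) (0\<^sub>m k l) = x \<otimes>\<^sub>m beta 1 1"
    "extension (0\<^sub>m (k * 3) (l * 3)) (0\<^sub>m k l) x (0\<^sub>m k l) = x \<otimes>\<^sub>m beta 1 2"
    "extension (0\<^sub>m (k * 3) (l * 3)) (0\<^sub>m k l) (0\<^sub>m k l) x = x \<otimes>\<^sub>m beta 1 3"
    using assms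
    by (simp_all add: extension_def diag3_single kron_beta_1 munit_reduce del: One_nat_def)
qed

lemma alg_carrier': "b \<in> alg n \<Longrightarrow> b \<in> carrier_mat (3 ^ n * 3) (3 ^ n * 3)"
  using alg_carrier [of b n] by (simp add: mult.commute)

text \<open>The alphas, and the betas with k at least 2, come from the previous level by a trailing
  e_22. Only the terms with \<open>beta 1 j\<close> are new.\<close>

lemma gens_Suc:
  "gens (Suc n) = (\<lambda>g. g \<otimes>\<^sub>m munit 2 2) ` gens n \<union>
    {x \<otimes>\<^sub>m beta 1 j | x j. j \<in> {1, 2, 3} \<and> x \<in> carrier_mat (3 ^ n) (3 ^ n)}"
proof -
  \<comment> \<open>The exponent m is kept apart from k because raising both n and k by one leaves
    it unchanged: \<open>Suc n - Suc k = n - k\<close>.\<close>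
  define L where
    "L m k = {x \<otimes>\<^sub>m beta k j | x j. j \<in> {1, 2, 3} \<and> x \<in> carrier_mat (3 ^ m) (3 ^ m)}" for m k
  have gens: "gens n = {alpha n j | j. j \<in> {1, 2, 3}} \<union> (\<Union>k\<in>{1..n}. L (n - k) k)" for n
    unfolding gens_def L_def by blast
  have L_Suc: "L m (Suc k) = (\<lambda>g. g \<otimes>\<^sub>m munit 2 2) ` L m k" if "k \<ge> 1" for m k
  proof -
    have "L m (Suc k) =
        {(x \<otimes>\<^sub>m beta k j) \<otimes>\<^sub>m munit 2 2 | x j. j \<in> {1, 2, 3} \<and> x \<in> carrier_mat (3 ^ m) (3 ^ m)}"
      unfolding L_def beta_Suc [OF that] kron_assoc ..
    then show ?thesis
      unfolding L_def by blast
  qed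
  have Icc: "{1..Suc n} = insert 1 (Suc ` {1..n})"
    unfolding image_Suc_atLeastAtMost by auto
  have "(\<Union>k\<in>{1..Suc n}. L (Suc n - k) k) = L n 1 \<union> (\<Union>k\<in>{1..n}. L (n - k) (Suc k))"
    by (simp only: Icc image_insert image_image Union_insert diff_Suc_Suc diff_Suc_1)
  moreover have "(\<Union>k\<in>{1..n}. L (n - k) (Suc k)) =
      (\<lambda>g. g \<otimes>\<^sub>m munit 2 2) ` (\<Union>k\<in>{1..n}. L (n - k) k)"
    unfolding image_UN by (intro SUP_cong refl L_Suc) simp
  moreover have "L n 1 =
      {x \<otimes>\<^sub>m beta 1 j | x j. j \<in> {1, 2, 3} \<and> x \<in> carrier_mat (3 ^ n) (3 ^ n)}"
    unfolding L_def ..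
  moreover have "{alpha (Suc n) j | j. j \<in> {1, 2, 3}} =
      (\<lambda>g. g \<otimes>\<^sub>m munit 2 2) ` {alpha n j | j. j \<in> {1, 2, 3}}"
    unfolding alpha_Suc by blast
  ultimately show ?thesis
    unfolding gens image_Un by (simp only: Un_ac)
qed

text \<open>Appending e_22 is linear, so the preimage of \<open>alg (Suc n)\<close> is a submodule,
  and it contains the generators by \<open>gens_Suc\<close>.\<close>

lemma kron_munit_in_alg_Suc:
  assumes "b \<in> alg n"
  shows "b \<otimes>\<^sub>m munit 2 2 \<in> alg (Suc n)"
proof -
  define N where
    "N = {b \<in> carrier_mat (3 ^ Suc n) (3 ^ Suc n). b \<otimes>\<^sub>m munit 2 2 \<in> alg (Suc n)}"
  have "submodule class_ring N (mats n)"
    using alg_zero [of "Suc n"]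
    by (intro submodule_matsI)
      (auto simp: N_def alg_add alg_smult kron_add_left kron_smult_left kron_zero_left mult.commute)
  moreover have "gens n \<subseteq> N"
    using gens_carrier [of n] gens_subset_alg [of "Suc n"] by (auto simp: N_def gens_Suc)
  ultimately have "alg n \<subseteq> N"
    by (rule alg_least)
  then show ?thesis
    using assms by (auto simp: N_def)
qed

text \<open>Every choice of midpoint values is admissible: by linearity the extension is the sum of
  b with e_22 appended and three \<open>beta 1 j\<close> terms.\<close>

lemma extension_in_alg:
  assumes b: "b \<in> alg n" and xyz: "x \<in> carrier_mat (3 ^ n) (3 ^ n)"
    "y \<in> carrier_mat (3 ^ n) (3 ^ n)" "z \<in> carrier_mat (3 ^ n) (3 ^ n)"
  shows "extension b x y z \<in> alg (Suc n)"
proof -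
  let ?o = "0\<^sub>m (3 ^ n) (3 ^ n)" and ?O = "0\<^sub>m (3 ^ n * 3) (3 ^ n * 3)"
  have "extension b x y z =
      extension b ?o ?o ?o + extension ?O x ?o ?o + extension ?O ?o y ?o + extension ?O ?o ?o z"
    using alg_carrier' [OF b] xyz
    by (simp add: extension_add [where k = "3 ^ n" and l = "3 ^ n"])
  also have "\<dots> = b \<otimes>\<^sub>m munit 2 2 + x \<otimes>\<^sub>m beta 1 1 + y \<otimes>\<^sub>m beta 1 2 + z \<otimes>\<^sub>m beta 1 3"
    using alg_carrier' [OF b] xyz by (simp add: extension_base extension_beta)
  also have "\<dots> \<in> alg (Suc n)"
  proof -
    have "u \<otimes>\<^sub>m beta 1 j \<in> alg (Suc n)"
      if "u \<in> carrier_mat (3 ^ n) (3 ^ n)" "j \<in> {1, 2, 3}" for u j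
      using that gens_subset_alg [of "Suc n"] unfolding gens_Suc by blast
    then show ?thesis
      using b xyz by (intro alg_add kron_munit_in_alg_Suc) auto
  qed
  finally show ?thesis .
qed

text \<open>Converse of \<open>extension_in_alg\<close>: the extensions form a submodule containing
  all generators. Hence the elements restricting to a given b are parametrised by three arbitrary
  matrices.\<close>

lemma alg_SucE:
  assumes "a \<in> alg (Suc n)"
  obtains b x y z where "a = extension b x y z" "b \<in> alg n" "x \<in> carrier_mat (3 ^ n) (3 ^ n)"
    "y \<in> carrier_mat (3 ^ n) (3 ^ n)" "z \<in> carrier_mat (3 ^ n) (3 ^ n)"
proof -
  let ?C = "carrier_mat (3 ^ n) (3 ^ n) :: complex mat set"
  define N where
    "N = {extension b x y z | b x y z. b \<in> alg n \<and> x \<in> ?C \<and> y \<in> ?C \<and> z \<in> ?C}"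
  have NI: "extension b x y z \<in> N" if "b \<in> alg n" "x \<in> ?C" "y \<in> ?C" "z \<in> ?C" for b x y z
    using that by (auto simp: N_def)
  let ?o = "0\<^sub>m (3 ^ n) (3 ^ n) :: complex mat"
  let ?O = "0\<^sub>m (3 ^ n * 3) (3 ^ n * 3) :: complex mat"
  have O: "?O \<in> alg n"
    using alg_zero [of n] by (simp add: mult.commute)
  have "submodule class_ring N (mats (Suc n))"
  proof (intro submodule_matsI)
    show "N \<subseteq> carrier_mat (3 ^ Suc (Suc n)) (3 ^ Suc (Suc n))"
      using extension_in_alg alg_carrier unfolding N_def by blast
    have "0\<^sub>m (3 ^ Suc (Suc n)) (3 ^ Suc (Suc n)) = extension ?O ?o ?o ?o"
      by (simp add: extension_def diag3_zero mult.commute)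
    then show "0\<^sub>m (3 ^ Suc (Suc n)) (3 ^ Suc (Suc n)) \<in> N"
      using NI [OF O] by simp
  next
    fix u v assume "u \<in> N" "v \<in> N"
    then obtain b x y z b' x' y' z' where "u = extension b x y z" "v = extension b' x' y' z'"
      and "b \<in> alg n" "x \<in> ?C" "y \<in> ?C" "z \<in> ?C" "b' \<in> alg n" "x' \<in> ?C" "y' \<in> ?C" "z' \<in> ?C"
      by (auto simp: N_def)
    then show "u + v \<in> N"
      using NI [of "b + b'" "x + x'" "y + y'" "z + z'"]
      by (simp add: extension_add [where k = "3 ^ n" and l = "3 ^ n"] alg_carrier' alg_add)
  next
    fix s u assume "u \<in> N"
    then obtain b x y z where "u = extension b x y z" "b \<in> alg n" "x \<in> ?C" "y \<in> ?C" "z \<in> ?C"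
      by (auto simp: N_def)
    then show "s \<cdot>\<^sub>m u \<in> N"
      using NI [of "s \<cdot>\<^sub>m b" "s \<cdot>\<^sub>m x" "s \<cdot>\<^sub>m y" "s \<cdot>\<^sub>m z"]
      by (simp add: extension_smult [where k = "3 ^ n" and l = "3 ^ n"] alg_carrier' alg_smult)
  qed
  moreover have "gens (Suc n) \<subseteq> N"
  proof -
    have "g \<otimes>\<^sub>m munit 2 2 \<in> N" if "g \<in> gens n" for g
    proof -
      have "g \<in> alg n"
        using that gens_subset_alg by blast
      then show ?thesis
        using NI [of g ?o ?o ?o] by (simp add: extension_base alg_carrier')
    qed
    moreover have "x \<otimes>\<^sub>m beta 1 1 \<in> N" "x \<otimes>\<^sub>m beta 1 2 \<in> N" "x \<otimes>\<^sub>m beta 1 3 \<in> N" if "x \<in> ?C" for x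
      using that NI [OF O, of x ?o ?o] NI [OF O, of ?o x ?o] NI [OF O, of ?o ?o x]
      by (simp_all add: extension_beta del: One_nat_def)
    ultimately show ?thesis
      by (auto simp: gens_Suc)
  qed
  ultimately have "alg (Suc n) \<subseteq> N"
    by (rule alg_least)
  with assms that show ?thesis
    unfolding N_def by blast
qed

text \<open>At positive levels the outer \<open>diag3\<close> of \<open>extension\<close> already
  has this form. Level 0 is treated directly, its generators being the diagonal matrix
  units.\<close>

lemma alg_diag3E:
  assumes "b \<in> alg n"
  obtains x y z where "b = diag3 x y z" "x \<in> carrier_mat (3 ^ n) (3 ^ n)"
    "y \<in> carrier_mat (3 ^ n) (3 ^ n)" "z \<in> carrier_mat (3 ^ n) (3 ^ n)"
proof (cases n)
  case (Suc m)
  with assms obtain c x y z where "b = extension c x y z" "c \<in> alg m"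
    "x \<in> carrier_mat (3 ^ m) (3 ^ m)" "y \<in> carrier_mat (3 ^ m) (3 ^ m)"
    "z \<in> carrier_mat (3 ^ m) (3 ^ m)"
    by (auto elim: alg_SucE)
  then show ?thesis
    using Suc by (intro that [of "diag3 x y z" c "diag3 y z x"])
      (auto simp: extension_def alg_carrier' mult.commute [of 3])
next
  case 0
  let ?C = "carrier_mat 1 1 :: complex mat set"
  define N where "N = {diag3 x y z | x y z. x \<in> ?C \<and> y \<in> ?C \<and> z \<in> ?C}"
  have NI: "diag3 x y z \<in> N" if "x \<in> ?C" "y \<in> ?C" "z \<in> ?C" for x y z
    using that by (auto simp: N_def)
  have "submodule class_ring N (mats 0)"
  proof (intro submodule_matsI)
    show "N \<subseteq> carrier_mat (3 ^ Suc 0) (3 ^ Suc 0)"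
      by (auto simp: N_def)
    show "0\<^sub>m (3 ^ Suc 0) (3 ^ Suc 0) \<in> N"
      using NI [of "0\<^sub>m 1 1" "0\<^sub>m 1 1" "0\<^sub>m 1 1"] diag3_zero [of 1 1] by simp
  next
    fix u v assume "u \<in> N" "v \<in> N"
    then obtain x y z x' y' z' where "u = diag3 x y z" "v = diag3 x' y' z'"
      and "x \<in> ?C" "y \<in> ?C" "z \<in> ?C" "x' \<in> ?C" "y' \<in> ?C" "z' \<in> ?C"
      by (auto simp: N_def)
    then show "u + v \<in> N"
      using NI [of "x + x'" "y + y'" "z + z'"] by (simp add: diag3_add [where k = 1 and l = 1])
  next
    fix s u assume "u \<in> N"
    then obtain x y z where "u = diag3 x y z" "x \<in> ?C" "y \<in> ?C" "z \<in> ?C"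
      by (auto simp: N_def)
    then show "s \<cdot>\<^sub>m u \<in> N"
      using NI [of "s \<cdot>\<^sub>m x" "s \<cdot>\<^sub>m y" "s \<cdot>\<^sub>m z"] by (simp add: diag3_smult [where k = 1 and l = 1])
  qed
  moreover have "gens 0 \<subseteq> N"
    using NI [of "1\<^sub>m 1" "0\<^sub>m 1 1" "0\<^sub>m 1 1"] NI [of "0\<^sub>m 1 1" "1\<^sub>m 1" "0\<^sub>m 1 1"]
      NI [of "0\<^sub>m 1 1" "0\<^sub>m 1 1" "1\<^sub>m 1"]
    by (auto simp: gens_def alpha_0 kron_one_left diag3_single simp del: One_nat_def)
  ultimately have "alg 0 \<subseteq> N"
    by (rule alg_least)
  with assms that show ?thesis
    unfolding N_def using 0 by auto
qed

section \<open>The harmonic extension\<close>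

text \<open>The 2/5-2/5-1/5 rule of the Sierpinski gasket: \<open>A\<close> and \<open>B\<close> are
  the values at the ends of an edge, \<open>C\<close> is the value at the opposite corner, and the
  result belongs to the midpoint.\<close>

definition harm :: "complex mat \<Rightarrow> complex mat \<Rightarrow> complex mat \<Rightarrow> complex mat" where
  "harm A B C = (2/5) \<cdot>\<^sub>m A + (2/5) \<cdot>\<^sub>m B + (1/5) \<cdot>\<^sub>m C"

lemma harm_carrier [simp, intro]: "C \<in> carrier_mat k l \<Longrightarrow> harm A B C \<in> carrier_mat k l"
  by (simp add: harm_def)

lemma dim_phi_alpha [simp]: "dim_row (phi_alpha j) = 9" "dim_col (phi_alpha j) = 9"
  by (simp_all add: phi_alpha_def beta_1 [unfolded One_nat_def])

lemma phi_munit: "phi (munit 1 1) = phi_alpha 1" "phi (munit 2 2) = phi_alpha 2"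
    "phi (munit 3 3) = phi_alpha 3"
  by (auto intro!: eq_matI simp: phi_def munit_def pos_def)

lemma alpha_1: "alpha 1 j = munit j j \<otimes>\<^sub>m munit 2 2"
  using alpha_Suc [of 0 j] by (simp add: alpha_0)

lemma phi_alpha_eq:
  shows "phi_alpha 1 = munit 1 1 \<otimes>\<^sub>m munit 2 2
    + (2/5) \<cdot>\<^sub>m (munit 1 1 \<otimes>\<^sub>m munit 1 1 + munit 3 3 \<otimes>\<^sub>m munit 3 3)
    + (2/5) \<cdot>\<^sub>m (munit 2 2 \<otimes>\<^sub>m munit 1 1 + munit 1 1 \<otimes>\<^sub>m munit 3 3)
    + (1/5) \<cdot>\<^sub>m (munit 3 3 \<otimes>\<^sub>m munit 1 1 + munit 2 2 \<otimes>\<^sub>m munit 3 3)"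
    and "phi_alpha 2 = munit 2 2 \<otimes>\<^sub>m munit 2 2
    + (2/5) \<cdot>\<^sub>m (munit 2 2 \<otimes>\<^sub>m munit 1 1 + munit 1 1 \<otimes>\<^sub>m munit 3 3)
    + (2/5) \<cdot>\<^sub>m (munit 3 3 \<otimes>\<^sub>m munit 1 1 + munit 2 2 \<otimes>\<^sub>m munit 3 3)
    + (1/5) \<cdot>\<^sub>m (munit 1 1 \<otimes>\<^sub>m munit 1 1 + munit 3 3 \<otimes>\<^sub>m munit 3 3)"
    and "phi_alpha 3 = munit 3 3 \<otimes>\<^sub>m munit 2 2
    + (2/5) \<cdot>\<^sub>m (munit 3 3 \<otimes>\<^sub>m munit 1 1 + munit 2 2 \<otimes>\<^sub>m munit 3 3)
    + (2/5) \<cdot>\<^sub>m (munit 1 1 \<otimes>\<^sub>m munit 1 1 + munit 3 3 \<otimes>\<^sub>m munit 3 3)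
    + (1/5) \<cdot>\<^sub>m (munit 2 2 \<otimes>\<^sub>m munit 1 1 + munit 1 1 \<otimes>\<^sub>m munit 3 3)"
  by (simp_all add: phi_alpha_def alpha_1 beta_1 munit_reduce del: One_nat_def)

text \<open>Collect the coefficient of \<open>beta 1 j\<close>: the corners j and j - 1 contribute
  with weight 2/5, the corner j + 1 with weight 1/5, indices mod 3.\<close>

lemma id_tensor_phi_diag3:
  assumes "A \<in> carrier_mat k l" "B \<in> carrier_mat k l" "C \<in> carrier_mat k l"
  shows "id_tensor_phi (diag3 A B C) =
    extension (diag3 A B C) (harm A C B) (harm A B C) (harm B C A)"
proof -
  \<comment> \<open>The left side splits positions once by 9, the right side twice by 3; these rules
    reconcile the two.\<close>
  have digits: "r div 3 div 3 = r div 9" "r mod 9 div 3 = r div 3 mod 3" "r mod 9 mod 3 = r mod 3"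
    for r :: nat
    using mod_mult2_eq [of r 3 3] by (simp_all add: mod_mod_cancel flip: div_mult2_eq)
  have less: "r div 9 < k" "r div 3 < k * 3" if "r < k * 9" for r k :: nat
    using that by linarith+
  show ?thesis
  proof (intro eq_matI)
    fix r c
    assume "r < dim_row (extension (diag3 A B C) (harm A C B) (harm A B C) (harm B C A))"
      "c < dim_col (extension (diag3 A B C) (harm A C B) (harm A B C) (harm B C A))"
    then have rc: "r < k * 9" "c < l * 9"
      using assms by (simp_all add: extension_def harm_def)
    show "id_tensor_phi (diag3 A B C) $$ (r, c) =
      extension (diag3 A B C) (harm A C B) (harm A B C) (harm B C A) $$ (r, c)"
      using assms rc less [OF rc(1)] less [OF rc(2)]
      unfolding id_tensor_phi_def phi_munit slice_diag3 [OF assms] phi_alpha_eq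
      by (simp add: extension_def diag3_def harm_def digits)
        (simp add: algebra_simps add_divide_distrib)
  qed (use assms in \<open>simp_all add: id_tensor_phi_def slice_diag3 [OF assms] phi_munit
    extension_def harm_def\<close>)
qed

section \<open>Energy of the subdivided triangle\<close>

text \<open>
  The harmonic values minimise this quadratic form; the last two lines on the right are the
  form centred at its minimum.
\<close>

lemma triangle_energy_real:
  fixes a b c x y z :: real
  assumes "p = 2/5 * a + 2/5 * c + 1/5 * b" "q = 2/5 * a + 2/5 * b + 1/5 * c"
    "r = 2/5 * b + 2/5 * c + 1/5 * a"
  shows "(x - a)\<^sup>2 + (y - b)\<^sup>2 + (z - c)\<^sup>2 + (a - y)\<^sup>2 + (b - z)\<^sup>2 + (c - x)\<^sup>2
      + (y - x)\<^sup>2 + (z - y)\<^sup>2 + (x - z)\<^sup>2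
    = 3/5 * ((a - b)\<^sup>2 + (b - c)\<^sup>2 + (c - a)\<^sup>2)
      + 2 * ((x - p)\<^sup>2 + (y - q)\<^sup>2 + (z - r)\<^sup>2)
      + (((x - p) - (y - q))\<^sup>2 + ((y - q) - (z - r))\<^sup>2 + ((z - r) - (x - p))\<^sup>2)"
  unfolding assms by (simp add: field_simps power2_eq_square)

text \<open>The harmonic weights are real, so the real identity applies separately to real and
  imaginary parts, and the two are added.\<close>

lemma triangle_energy_complex:
  fixes a b c x y z :: complex
  assumes "p = 2/5 * a + 2/5 * c + 1/5 * b" "q = 2/5 * a + 2/5 * b + 1/5 * c"
    "r = 2/5 * b + 2/5 * c + 1/5 * a"
  shows "(cmod (x - a))\<^sup>2 + (cmod (y - b))\<^sup>2 + (cmod (z - c))\<^sup>2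
      + (cmod (a - y))\<^sup>2 + (cmod (b - z))\<^sup>2 + (cmod (c - x))\<^sup>2
      + (cmod (y - x))\<^sup>2 + (cmod (z - y))\<^sup>2 + (cmod (x - z))\<^sup>2
    = 3/5 * ((cmod (a - b))\<^sup>2 + (cmod (b - c))\<^sup>2 + (cmod (c - a))\<^sup>2)
      + 2 * ((cmod (x - p))\<^sup>2 + (cmod (y - q))\<^sup>2 + (cmod (z - r))\<^sup>2)
      + ((cmod ((x - p) - (y - q)))\<^sup>2 + (cmod ((y - q) - (z - r)))\<^sup>2
        + (cmod ((z - r) - (x - p)))\<^sup>2)"
proof -
  have "Re p = 2/5 * Re a + 2/5 * Re c + 1/5 * Re b" "Re q = 2/5 * Re a + 2/5 * Re b + 1/5 * Re c"
    "Re r = 2/5 * Re b + 2/5 * Re c + 1/5 * Re a"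
    "Im p = 2/5 * Im a + 2/5 * Im c + 1/5 * Im b" "Im q = 2/5 * Im a + 2/5 * Im b + 1/5 * Im c"
    "Im r = 2/5 * Im b + 2/5 * Im c + 1/5 * Im a"
    unfolding assms by simp_all
  from arg_cong2 [where f = "(+)", OF triangle_energy_real [OF this(1-3), of "Re x" "Re y" "Re z"]
    triangle_energy_real [OF this(4-6), of "Im x" "Im y" "Im z"]]
  show ?thesis
    unfolding cmod_power2 minus_complex.sel by (simp only: distrib_left add_ac)
qed

text \<open>The scalar identity is summed over all entries. The doubling in
  \<open>energy_diag3\<close> turns its coefficients 2 and 1 of the deviation terms into 4 and
  2.\<close>

lemma energy_extension:
  assumes "A \<in> carrier_mat k l" "B \<in> carrier_mat k l" "C \<in> carrier_mat k l"
    and "x \<in> carrier_mat k l" "y \<in> carrier_mat k l" "z \<in> carrier_mat k l"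
    and pqr: "p = harm A C B" "q = harm A B C" "r = harm B C A"
  shows "energy (extension (diag3 A B C) x y z) = 3/5 * energy (diag3 A B C)
    + 4 * (hs (x - p) + hs (y - q) + hs (z - r))
    + 2 * (hs ((x - p) - (y - q)) + hs ((y - q) - (z - r)) + hs ((z - r) - (x - p)))"
proof -
  have carr: "p \<in> carrier_mat k l" "q \<in> carrier_mat k l" "r \<in> carrier_mat k l"
    using assms by auto
  \<comment> \<open>Each difference of two outer blocks is again a \<open>diag3\<close>, giving nine
    terms: the edges of the small triangles A x y, B y z and C z x.\<close>
  have "energy (extension (diag3 A B C) x y z) = 2 *
    (hs (x - A) + hs (y - B) + hs (z - C) + hs (A - y) + hs (B - z) + hs (C - x)
      + hs (y - x) + hs (z - y) + hs (x - z))"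
    using assms
    by (simp add: extension_def energy_diag3 [where k = "k * 3" and l = "l * 3"]
        diag3_minus [where k = k and l = l] hs_diag3 [where k = k and l = l] minus_carrier_mat)
  also have "hs (x - A) + hs (y - B) + hs (z - C) + hs (A - y) + hs (B - z) + hs (C - x)
      + hs (y - x) + hs (z - y) + hs (x - z)
    = 3/5 * (hs (A - B) + hs (B - C) + hs (C - A)) + 2 * (hs (x - p) + hs (y - q) + hs (z - r))
      + (hs ((x - p) - (y - q)) + hs ((y - q) - (z - r)) + hs ((z - r) - (x - p)))"
  proof -
    \<comment> \<open>An abstract name for the double sum lets all norms be gathered under one
      \<open>S\<close>, so that \<open>S_cong\<close> leaves a single scalar identity.\<close>
    define S where "S f = (\<Sum>r<k. \<Sum>c<l. f r c)" for f :: "nat \<Rightarrow> nat \<Rightarrow> real"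
    have S_add: "S f + S g = S (\<lambda>r c. f r c + g r c)" and S_mult: "t * S f = S (\<lambda>r c. t * f r c)"
      for f g t
      by (simp_all add: S_def sum.distrib sum_distrib_left)
    have S_cong: "S f = S g" if "\<And>r c. r < k \<Longrightarrow> c < l \<Longrightarrow> f r c = g r c" for f g
      using that by (simp add: S_def)
    have hs_S: "hs (u - v) = S (\<lambda>r c. (cmod (u $$ (r, c) - v $$ (r, c)))\<^sup>2)"
      if "u \<in> carrier_mat k l" "v \<in> carrier_mat k l" for u v
      unfolding S_def by (rule hs_minus [OF that])
    have index: "(u - v) $$ (r, c) = u $$ (r, c) - v $$ (r, c)"
      if "u \<in> carrier_mat k l" "v \<in> carrier_mat k l" "r < k" "c < l" for u v r c
      using that by simp
    note carriers = assms(1-6) carr minus_carrier_mat [OF carr(1), of x]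
      minus_carrier_mat [OF carr(2), of y] minus_carrier_mat [OF carr(3), of z]
    show ?thesis
      by (simp only: hs_S carriers S_add S_mult, intro S_cong, simp only: index carriers,
          rule triangle_energy_complex)
        (use assms(1-6) in \<open>simp_all add: pqr harm_def\<close>)
  qed
  finally show ?thesis
    using assms by (simp add: energy_diag3 [where k = k and l = l])
qed

section \<open>The infimum and its unique minimiser\<close>

theorem proposition4p3:
  fixes n :: nat and b :: "complex mat"
  assumes "b \<in> alg n"
  shows "Inf {energy a | a. a \<in> alg (n + 1) \<and> rho a = b} = 3/5 * energy b
    \<and> {a \<in> alg (n + 1). rho a = b \<and>
         energy a = Inf {energy a' | a'. a' \<in> alg (n + 1) \<and> rho a' = b}}
      = {id_tensor_phi b}"
proof -
  let ?C = "carrier_mat (3 ^ n) (3 ^ n) :: complex mat set"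
  obtain A B C where b: "b = diag3 A B C" and ABC: "A \<in> ?C" "B \<in> ?C" "C \<in> ?C"
    using alg_diag3E [OF assms] .
  define p q r where pqr: "p = harm A C B" "q = harm A B C" "r = harm B C A"
  have pqr_carr: "p \<in> ?C" "q \<in> ?C" "r \<in> ?C"
    using ABC by (auto simp: pqr)
  have phi: "id_tensor_phi b = extension b p q r"
    by (simp add: b pqr id_tensor_phi_diag3 [OF ABC])
  have phi_alg: "id_tensor_phi b \<in> alg (n + 1)" and phi_rho: "rho (id_tensor_phi b) = b"
    using extension_in_alg [OF assms pqr_carr] rho_extension [OF alg_carrier' [OF assms] pqr_carr]
    by (simp_all add: phi)
  \<comment> \<open>At the harmonic midpoint values every deviation in
    \<open>energy_extension\<close> is zero.\<close>
  have phi_energy: "energy (id_tensor_phi b) = 3/5 * energy b"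
    using energy_extension [OF ABC pqr_carr pqr] pqr_carr by (simp add: phi hs_def flip: b)
  \<comment> \<open>The bound gives the infimum, and its equality case gives uniqueness.\<close>
  have above: "3/5 * energy b \<le> energy a \<and> (energy a = 3/5 * energy b \<longrightarrow> a = id_tensor_phi b)"
    if "a \<in> alg (n + 1)" "rho a = b" for a
  proof -
    have "a \<in> alg (Suc n)"
      using that(1) by simp
    then obtain b' x y z where a: "a = extension b' x y z" "b' \<in> alg n"
      and xyz: "x \<in> ?C" "y \<in> ?C" "z \<in> ?C"
      by (rule alg_SucE)
    \<comment> \<open>\<open>rho\<close> recovers the base, so only the three midpoint values remain
      free.\<close>
    then have "b' = b"
      using that(2) rho_extension [OF alg_carrier' xyz] by simp
    \<comment> \<open>The remainder in \<open>energy_extension\<close>: it is nonnegative, and its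
      first three norms alone force the harmonic values when it vanishes.\<close>
    define d where "d = 4 * (hs (x - p) + hs (y - q) + hs (z - r))
        + 2 * (hs ((x - p) - (y - q)) + hs ((y - q) - (z - r)) + hs ((z - r) - (x - p)))"
    note nonneg = hs_nonneg [of "x - p"] hs_nonneg [of "y - q"] hs_nonneg [of "z - r"]
      hs_nonneg [of "(x - p) - (y - q)"] hs_nonneg [of "(y - q) - (z - r)"]
      hs_nonneg [of "(z - r) - (x - p)"]
    have "energy a = 3/5 * energy b + d"
      using energy_extension [OF ABC xyz pqr] by (simp add: a \<open>b' = b\<close> b d_def)
    moreover have "d \<ge> 0"
      using nonneg by (simp add: d_def)
    moreover have "a = id_tensor_phi b" if "d = 0"
    proof -
      have "hs (x - p) = 0" "hs (y - q) = 0" "hs (z - r) = 0"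
        using that nonneg by (simp_all add: d_def add_nonneg_eq_0_iff)
      then have "x = p" "y = q" "z = r"
        using hs_minus_eq_0D xyz pqr_carr by blast+
      then show ?thesis
        by (simp add: a \<open>b' = b\<close> phi)
    qed
    ultimately show ?thesis
      by simp
  qed
  \<comment> \<open>\<open>Inf\<close> on the reals is meaningful only for nonempty sets that are
    bounded below; showing the value to be an attained minimum settles both.\<close>
  have Inf: "Inf {energy a | a. a \<in> alg (n + 1) \<and> rho a = b} = 3/5 * energy b"
  proof (rule cInf_eq_minimum)
    show "3/5 * energy b \<in> {energy a | a. a \<in> alg (n + 1) \<and> rho a = b}"
      using phi_alg phi_rho phi_energy by (metis (mono_tags, lifting) mem_Collect_eq)
  next
    fix e assume "e \<in> {energy a | a. a \<in> alg (n + 1) \<and> rho a = b}"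
    then show "3/5 * energy b \<le> e"
      using above by blast
  qed
  have "{a \<in> alg (n + 1). rho a = b \<and> energy a = 3/5 * energy b} = {id_tensor_phi b}"
    using above phi_alg phi_rho phi_energy by blast
  then show ?thesis
    unfolding Inf by blast
qed

end
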